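(* Let $X$ be a Banach space and let $K\subset B_X$ be a (nonempty) compact convex subset. If $X$ is $K$-URED, then the nearest point map from $B_X$ onto $K$ is uniformly continuous.
   Context: All Banach spaces are real; $B_X$ is the closed unit ball. A normed space $X$ is uniformly rotund in the direction $z\in X$ if whenever $(x_n),(y_n)$ are sequences in $X$ with $\|x_n\|=\|y_n\|=1$, $\lim_n\|\frac{x_n+y_n}{2}\|=1$, and $x_n-y_n=r_nz$ for some real numbers $r_n$, then $\lim_n\|x_n-y_n\|=0$. Given $K\subset X$, $X$ is $K$-URED if it is uniformly rotund in the direction $z$ for every $z\in\mathrm{span}(K)$. A nearest point map from $B_X$ onto $K$ is a map $R:B_X\to K$ with $\|R(x)-x\|=\inf_{y\in K}\|y-x\|$ for all $x\in B_X$. *)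

theory Defs
  imports "HOL-Analysis.Analysis"
begin

definition uniformly_rotund_in_direction :: "'a::real_normed_vector \<Rightarrow> bool" where
  "uniformly_rotund_in_direction z \<longleftrightarrow>
    (\<forall>(x :: nat \<Rightarrow> 'a) (y :: nat \<Rightarrow> 'a) (r :: nat \<Rightarrow> real).
      (\<forall>n. norm (x n) = 1) \<longrightarrow> (\<forall>n. norm (y n) = 1) \<longrightarrow>
      (\<lambda>n. norm ((1 / 2) *\<^sub>R (x n + y n))) \<longlonglongrightarrow> 1 \<longrightarrow>
      (\<forall>n. x n - y n = r n *\<^sub>R z) \<longrightarrow>
      (\<lambda>n. norm (x n - y n)) \<longlonglongrightarrow> 0)"

definition URED_wrt :: "'a::real_normed_vector set \<Rightarrow> bool" where
  "URED_wrt K \<longleftrightarrow> (\<forall>z \<in> span K. uniformly_rotund_in_direction z)"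

text \<open>Only the values of \<open>R\<close> on the closed unit ball matter. The infimum is meaningful only for
  nonempty \<open>K\<close>; for \<open>K = {}\<close> the predicate is false.\<close>

definition nearest_point_map :: "'a::real_normed_vector set \<Rightarrow> ('a \<Rightarrow> 'a) \<Rightarrow> bool" where
  "nearest_point_map K R \<longleftrightarrow>
    (\<forall>x \<in> cball 0 1. R x \<in> K \<and> norm (R x - x) = (INF y\<in>K. norm (y - x)))"

end

theory Submission
  imports Defs
begin

text \<open>Let \<open>x\<^sub>n\<close> and \<open>y\<^sub>n\<close> be points of the ball with \<open>\<parallel>x\<^sub>n - y\<^sub>n\<parallel> \<rightarrow> 0\<close>. By compactness of \<open>K\<close> it
  suffices to show that, along every subsequence for which they exist, the limits \<open>a\<close> of the nearest
  points of \<open>x\<^sub>n\<close> and \<open>b\<close> of those of \<open>y\<^sub>n\<close> agree. Both limits are asymptotically nearest to \<open>x\<^sub>n\<close>, so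
  convexity of \<open>K\<close> makes the distances from \<open>x\<^sub>n\<close> to \<open>a\<close>, to \<open>b\<close> and to their midpoint asymptotically
  equal. The chord from \<open>x\<^sub>n - a\<close> to \<open>x\<^sub>n - b\<close> is always the vector \<open>b - a \<in> span K\<close>; once it is
  prolonged at its shorter end until both ends have the same norm, rotundity in the direction
  \<open>b - a\<close> forces \<open>a = b\<close>.\<close>

lemma ray_meets_sphere:
  fixes u z :: "'a::real_normed_vector"
  assumes "z \<noteq> 0" and "norm u \<le> M"
  obtains t where "0 \<le> t" and "norm (u + t *\<^sub>R z) = M"
proof -
  define T where "T = (M + norm u) / norm z"
  have "0 \<le> M"
    using assms(2) norm_ge_zero order_trans by blast
  then have "0 \<le> T" and "norm (T *\<^sub>R z) = M + norm u"
    using assms(1) by (simp_all add: T_def)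
  then have "M \<le> norm (u + T *\<^sub>R z)"
    using norm_triangle_ineq2[of "T *\<^sub>R z" "- u"] by (simp add: add.commute)
  moreover have "continuous_on {0..T} (\<lambda>t. norm (u + t *\<^sub>R z))"
    by (intro continuous_intros)
  ultimately obtain t where "0 \<le> t" "norm (u + t *\<^sub>R z) = M"
    using IVT'[of "\<lambda>t. norm (u + t *\<^sub>R z)" 0 M T] assms(2) \<open>0 \<le> T\<close> by auto
  then show ?thesis
    by (rule that)
qed

lemma norm_midpoint_le_max:
  fixes u v :: "'a::real_normed_vector"
  shows "norm (midpoint u v) \<le> max (norm u) (norm v)"
  using norm_triangle_ineq[of u v] by (simp add: midpoint_def)

lemma prolong_chord_at_shorter_end:
  fixes u v :: "'a::real_normed_vector"
  assumes "u \<noteq> v" and "norm v \<le> norm u"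
  obtains q r where "norm q = norm u" and "u - q = r *\<^sub>R (u - v)" and "1 \<le> r"
    and "norm u - norm (midpoint u q) \<le> r * (norm u - norm (midpoint u v))"
proof -
  obtain s where s: "0 \<le> s" "norm (v + s *\<^sub>R (v - u)) = norm u"
    using ray_meets_sphere[of "v - u" v "norm u"] assms by auto
  define q where "q = v + s *\<^sub>R (v - u)"
  have chord: "u - q = (1 + s) *\<^sub>R (u - v)"
    by (simp add: q_def algebra_simps)
  have between: "(1 + s) *\<^sub>R midpoint u v = midpoint u q + s *\<^sub>R u"
    by (simp add: q_def midpoint_def algebra_simps add_divide_distrib flip: scaleR_2)
  have "(1 + s) * norm (midpoint u v) = norm (midpoint u q + s *\<^sub>R u)"
    using s(1) by (simp flip: between)
  also have "\<dots> \<le> norm (midpoint u q) + s * norm u"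
    using norm_triangle_ineq[of "midpoint u q" "s *\<^sub>R u"] s(1) by simp
  finally have "norm u - norm (midpoint u q) \<le> (1 + s) * (norm u - norm (midpoint u v))"
    by (simp add: algebra_simps)
  with s chord show ?thesis
    by (intro that[of q "1 + s"]) (simp_all add: q_def)
qed

lemma prolong_chord_to_sphere:
  fixes u v :: "'a::real_normed_vector"
  assumes "u \<noteq> v" and M: "M = max (norm u) (norm v)"
  obtains p q r where "norm p = M" and "norm q = M" and "p - q = r *\<^sub>R (u - v)" and "1 \<le> r"
    and "M - norm (midpoint p q) \<le> 2 * M / norm (u - v) * (M - norm (midpoint u v))"
proof -
  obtain p q r where p: "norm p = M" and q: "norm q = M" and chord: "p - q = r *\<^sub>R (u - v)"
    and r: "1 \<le> r" and gap: "M - norm (midpoint p q) \<le> r * (M - norm (midpoint u v))"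
  proof (cases "norm v \<le> norm u")
    case True
    then show ?thesis
      using prolong_chord_at_shorter_end[OF assms(1) True] M that[of u] True by auto
  next
    case False
    then have "norm u \<le> norm v"
      by simp
    from prolong_chord_at_shorter_end[OF assms(1)[symmetric] this]
    obtain p r where p: "norm p = norm v" and chord: "v - p = r *\<^sub>R (v - u)" and r: "1 \<le> r"
      and gap: "norm v - norm (midpoint v p) \<le> r * (norm v - norm (midpoint v u))" .
    have "p - v = r *\<^sub>R (u - v)"
      using arg_cong[OF chord, of uminus] by (simp flip: scaleR_minus_right)
    then show ?thesis
      using p r gap M \<open>norm u \<le> norm v\<close> by (intro that[of p v r]) (auto simp: midpoint_sym)
  qed
  have "norm (midpoint u v) \<le> M"
    unfolding M by (rule norm_midpoint_le_max)
  moreover have "r \<le> 2 * M / norm (u - v)"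
  proof -
    have "r * norm (u - v) \<le> 2 * M"
      using norm_triangle_ineq4[of p q] r by (simp add: chord p q)
    then show ?thesis
      using assms(1) by (simp add: pos_le_divide_eq)
  qed
  ultimately have "r * (M - norm (midpoint u v))
      \<le> 2 * M / norm (u - v) * (M - norm (midpoint u v))"
    by (intro mult_right_mono) auto
  with gap show ?thesis
    by (intro that[OF p q chord r]) simp
qed

lemma uniformly_rotund_in_direction_on_spheres:
  fixes p q :: "nat \<Rightarrow> 'a::real_normed_vector"
  assumes rot: "uniformly_rotund_in_direction z" and pos: "\<And>n. 0 < M n"
    and p: "\<And>n. norm (p n) = M n" and q: "\<And>n. norm (q n) = M n"
    and chord: "\<And>n. p n - q n = r n *\<^sub>R z"
    and mid: "(\<lambda>n. norm (midpoint (p n) (q n)) / M n) \<longlonglongrightarrow> 1"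
  shows "(\<lambda>n. norm (p n - q n) / M n) \<longlonglongrightarrow> 0"
proof -
  define p' q' where "p' n = (1 / M n) *\<^sub>R p n" and "q' n = (1 / M n) *\<^sub>R q n" for n
  have unit: "norm (p' n) = 1" "norm (q' n) = 1" for n
    using pos[of n] by (simp_all add: p'_def q'_def p q)
  have diff: "p' n - q' n = (1 / M n) *\<^sub>R (p n - q n)" for n
    by (simp add: p'_def q'_def scaleR_diff_right)
  have "(1 / 2) *\<^sub>R (p' n + q' n) = (1 / M n) *\<^sub>R midpoint (p n) (q n)" for n
    by (simp add: p'_def q'_def midpoint_def scaleR_add_right mult.commute)
  then have "norm ((1 / 2) *\<^sub>R (p' n + q' n)) = norm (midpoint (p n) (q n)) / M n" for n
    using pos[of n] by simp
  with mid have "(\<lambda>n. norm ((1 / 2) *\<^sub>R (p' n + q' n))) \<longlonglongrightarrow> 1"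
    by (simp only:)
  moreover have "p' n - q' n = (r n / M n) *\<^sub>R z" for n
    by (simp add: diff chord)
  ultimately have "(\<lambda>n. norm (p' n - q' n)) \<longlonglongrightarrow> 0"
    using rot[unfolded uniformly_rotund_in_direction_def, rule_format,
        of p' q' "\<lambda>n. r n / M n"] unit by (simp only:)
  moreover have "norm (p' n - q' n) = norm (p n - q n) / M n" for n
    using pos[of n] by (simp add: diff)
  ultimately show ?thesis
    by (simp only:)
qed

lemma prolong_constant_chords_to_spheres:
  fixes u v :: "nat \<Rightarrow> 'a::real_normed_vector"
  assumes z: "z \<noteq> 0" and diff: "\<And>n. u n - v n = z"
    and M: "\<And>n. M n = max (norm (u n)) (norm (v n))" and pos: "\<And>n. 0 < M n"
    and mid: "(\<lambda>n. M n - norm (midpoint (u n) (v n))) \<longlonglongrightarrow> 0"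
  obtains p q r where "\<And>n. norm (p n) = M n" and "\<And>n. norm (q n) = M n"
    and "\<And>n. p n - q n = r n *\<^sub>R z" and "\<And>n. 1 \<le> r n"
    and "(\<lambda>n. norm (midpoint (p n) (q n)) / M n) \<longlonglongrightarrow> 1"
proof -
  have "u n \<noteq> v n" for n
    using z diff[of n] by auto
  then have "\<exists>p q r. norm p = M n \<and> norm q = M n \<and> p - q = r *\<^sub>R z \<and> 1 \<le> r
      \<and> M n - norm (midpoint p q) \<le> 2 * M n / norm z * (M n - norm (midpoint (u n) (v n)))" for n
    using prolong_chord_to_sphere[OF _ M, of n] unfolding diff by blast
  then obtain p q r where p: "\<And>n. norm (p n) = M n" and q: "\<And>n. norm (q n) = M n"
    and chord: "\<And>n. p n - q n = r n *\<^sub>R z" and r: "\<And>n. 1 \<le> r n"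
    and gap: "\<And>n. M n - norm (midpoint (p n) (q n))
        \<le> 2 * M n / norm z * (M n - norm (midpoint (u n) (v n)))"
    by metis
  have "(\<lambda>n. 1 - norm (midpoint (p n) (q n)) / M n) \<longlonglongrightarrow> 0"
  proof (rule tendsto_sandwich[OF _ _ tendsto_const])
    have "norm (midpoint (p n) (q n)) \<le> M n" for n
      using norm_midpoint_le_max[of "p n" "q n"] by (simp add: p q)
    then show "\<forall>\<^sub>F n in sequentially. 0 \<le> 1 - norm (midpoint (p n) (q n)) / M n"
      using pos by simp
    have "1 - norm (midpoint (p n) (q n)) / M n
        \<le> 2 / norm z * (M n - norm (midpoint (u n) (v n)))" for n
      using divide_right_mono[OF gap[of n], of "M n"] pos[of n] by (simp add: diff_divide_distrib)
    then show "\<forall>\<^sub>F n in sequentially. 1 - norm (midpoint (p n) (q n)) / M n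
        \<le> 2 / norm z * (M n - norm (midpoint (u n) (v n)))"
      by simp
    show "(\<lambda>n. 2 / norm z * (M n - norm (midpoint (u n) (v n)))) \<longlonglongrightarrow> 0"
      using mid by (rule tendsto_mult_right_zero)
  qed
  from tendsto_diff[OF tendsto_const[of 1] this]
  have "(\<lambda>n. norm (midpoint (p n) (q n)) / M n) \<longlonglongrightarrow> 1"
    by simp
  with p q chord r show ?thesis
    by (rule that)
qed

lemma uniformly_rotund_in_direction_constant_chord_eq_zero:
  fixes u v :: "nat \<Rightarrow> 'a::real_normed_vector"
  assumes rot: "uniformly_rotund_in_direction z" and diff: "\<And>n. u n - v n = z"
    and bdd: "bounded (range u)"
    and mid: "(\<lambda>n. max (norm (u n)) (norm (v n)) - norm (midpoint (u n) (v n))) \<longlonglongrightarrow> 0"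
  shows "z = 0"
proof (rule ccontr)
  assume z: "z \<noteq> 0"
  define M where "M n = max (norm (u n)) (norm (v n))" for n
  have pos: "0 < M n" for n
    using z diff[of n] by (auto simp: M_def less_max_iff_disj)
  obtain B where B: "\<And>n. M n \<le> B"
  proof -
    obtain C where C: "norm (u n) \<le> C" for n
      using bdd by (auto simp: bounded_iff)
    have "norm (v n) \<le> C + norm z" for n
      using norm_triangle_ineq4[of "u n" z] C[of n] by (simp flip: diff[of n])
    with C that[of "C + norm z"] show ?thesis
      by (simp add: M_def add_increasing2)
  qed
  obtain p q r where p: "\<And>n. norm (p n) = M n" and q: "\<And>n. norm (q n) = M n"
    and chord: "\<And>n. p n - q n = r n *\<^sub>R z" and r: "\<And>n. 1 \<le> r n"
    and mid': "(\<lambda>n. norm (midpoint (p n) (q n)) / M n) \<longlonglongrightarrow> 1"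
    by (rule prolong_constant_chords_to_spheres[OF z diff M_def pos mid[folded M_def]]) (rule that)
  have "(\<lambda>n. norm (p n - q n) / M n) \<longlonglongrightarrow> 0"
    using rot pos p q chord mid' by (rule uniformly_rotund_in_direction_on_spheres)
  moreover have "norm z / B \<le> norm (p n - q n) / M n" for n
    using pos[of n] B[of n] r[of n] mult_right_mono[OF r[of n], of "norm z"]
    by (intro frac_le) (auto simp: chord)
  ultimately have "norm z / B \<le> 0"
    by (intro LIMSEQ_le_const) auto
  moreover have "0 < B"
    using pos[of 0] B[of 0] by linarith
  ultimately show False
    using z by (simp add: divide_le_0_iff)
qed

definition asymptotically_nearest ::
    "'a::metric_space set \<Rightarrow> (nat \<Rightarrow> 'a) \<Rightarrow> (nat \<Rightarrow> 'a) \<Rightarrow> bool" where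
  "asymptotically_nearest K x p \<longleftrightarrow> (\<lambda>n. dist (x n) (p n) - infdist (x n) K) \<longlonglongrightarrow> 0"

lemma asymptotically_nearest_perturb:
  assumes xp: "asymptotically_nearest K x p"
    and xy: "(\<lambda>n. dist (x n) (y n)) \<longlonglongrightarrow> 0" and pq: "(\<lambda>n. dist (p n) (q n)) \<longlonglongrightarrow> 0"
  shows "asymptotically_nearest K y q"
proof -
  let ?excess = "\<lambda>x p n. dist (x n) (p n) - infdist (x n) K"
  have "(\<lambda>n. ?excess y q n - ?excess x p n) \<longlonglongrightarrow> 0"
  proof (rule Lim_null_comparison)
    have "norm (?excess y q n - ?excess x p n) \<le> 2 * dist (x n) (y n) + dist (p n) (q n)" for n
    proof -
      have "\<bar>dist (y n) (q n) - dist (x n) (p n)\<bar> \<le> dist (x n) (y n) + dist (p n) (q n)"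
        by metric
      then show ?thesis
        using infdist_triangle_abs[of "x n" K "y n"] by simp
    qed
    then show "\<forall>\<^sub>F n in sequentially. norm (?excess y q n - ?excess x p n)
        \<le> 2 * dist (x n) (y n) + dist (p n) (q n)"
      by simp
    show "(\<lambda>n. 2 * dist (x n) (y n) + dist (p n) (q n)) \<longlonglongrightarrow> 0"
      using tendsto_add[OF tendsto_mult_right_zero[OF xy, of 2] pq] by simp
  qed
  from tendsto_add[OF this xp[unfolded asymptotically_nearest_def]] show ?thesis
    by (simp add: asymptotically_nearest_def)
qed

lemma asymptotically_nearest_unique:
  fixes K :: "'a::real_normed_vector set"
  assumes K: "convex K" "URED_wrt K" and a: "a \<in> K" and b: "b \<in> K"
    and bdd: "bounded (range x)"
    and xa: "asymptotically_nearest K x (\<lambda>_. a)" and xb: "asymptotically_nearest K x (\<lambda>_. b)"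
  shows "a = b"
proof -
  let ?d = "\<lambda>n. infdist (x n) K"
  have "midpoint a b \<in> K"
    using K(1) a b by (meson convex_contains_segment midpoint_in_closed_segment subsetD)
  have midpoint_diff: "midpoint (x n - a) (x n - b) = x n - midpoint a b" for n
    by (simp add: midpoint_def algebra_simps flip: scaleR_2)
  have "(\<lambda>n. max (norm (x n - a)) (norm (x n - b)) - norm (midpoint (x n - a) (x n - b))) \<longlonglongrightarrow> 0"
  proof (rule tendsto_sandwich[OF _ _ tendsto_const])
    show "\<forall>\<^sub>F n in sequentially.
        0 \<le> max (norm (x n - a)) (norm (x n - b)) - norm (midpoint (x n - a) (x n - b))"
      using norm_midpoint_le_max by (intro always_eventually allI) (simp only: diff_ge_0_iff_ge)
    show "\<forall>\<^sub>F n in sequentially.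
        max (norm (x n - a)) (norm (x n - b)) - norm (midpoint (x n - a) (x n - b))
        \<le> max (dist (x n) a - ?d n) (dist (x n) b - ?d n)"
      using infdist_le[OF \<open>midpoint a b \<in> K\<close>]
      by (simp add: midpoint_diff dist_norm flip: max_diff_distrib_left)
    show "(\<lambda>n. max (dist (x n) a - ?d n) (dist (x n) b - ?d n)) \<longlonglongrightarrow> 0"
      using tendsto_max[OF xa[unfolded asymptotically_nearest_def]
          xb[unfolded asymptotically_nearest_def]] by simp
  qed
  moreover have "uniformly_rotund_in_direction (b - a)"
    using K(2) a b by (simp add: URED_wrt_def span_base span_diff)
  moreover have "bounded (range (\<lambda>n. x n - a))"
    using bdd by (simp add: bounded_minus_comp)
  ultimately have "b - a = 0"
    by (intro uniformly_rotund_in_direction_constant_chord_eq_zero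
        [of _ "\<lambda>n. x n - a" "\<lambda>n. x n - b"]) auto
  then show ?thesis
    by simp
qed

lemma nearest_point_unique:
  fixes K :: "'a::real_normed_vector set"
  assumes "convex K" "URED_wrt K" and "a \<in> K" "dist x a = infdist x K"
    and "b \<in> K" "dist x b = infdist x K"
  shows "a = b"
  using assms by (intro asymptotically_nearest_unique[of K a b "\<lambda>_. x"])
    (simp_all add: asymptotically_nearest_def)

lemma compact_dist_tendsto_zero_if_subseq_limits_eq:
  fixes p q :: "nat \<Rightarrow> 'a::metric_space"
  assumes "compact K" and K: "\<And>n. p n \<in> K" "\<And>n. q n \<in> K"
    and limits: "\<And>k a b. strict_mono k \<Longrightarrow> a \<in> K \<Longrightarrow> b \<in> K
      \<Longrightarrow> (\<lambda>n. p (k n)) \<longlonglongrightarrow> a \<Longrightarrow> (\<lambda>n. q (k n)) \<longlonglongrightarrow> b \<Longrightarrow> a = b"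
  shows "(\<lambda>n. dist (p n) (q n)) \<longlonglongrightarrow> 0"
proof (rule ccontr)
  assume "\<not> ?thesis"
  then obtain e where "0 < e" and e: "\<not> (\<forall>\<^sub>F n in sequentially. dist (p n) (q n) < e)"
    by (auto simp: tendsto_iff)
  obtain j :: "nat \<Rightarrow> nat" where j: "strict_mono j" and far: "\<And>n. e \<le> dist (p (j n)) (q (j n))"
    using not_eventually_sequentiallyD[OF e] by (auto simp: not_less)
  have "seq_compact (K \<times> K)"
    using \<open>compact K\<close> by (simp add: compact_Times compact_imp_seq_compact)
  then obtain l i where l: "l \<in> K \<times> K" and i: "strict_mono (i :: nat \<Rightarrow> nat)"
    and lim: "((\<lambda>n. (p (j n), q (j n))) \<circ> i) \<longlonglongrightarrow> l"
    using K by (elim seq_compactE[where f = "\<lambda>n. (p (j n), q (j n))"]) simp_all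
  have p: "(\<lambda>n. p (j (i n))) \<longlonglongrightarrow> fst l" and q: "(\<lambda>n. q (j (i n))) \<longlonglongrightarrow> snd l"
    using tendsto_fst[OF lim] tendsto_snd[OF lim] by (simp_all add: o_def)
  have "fst l = snd l"
    using limits[OF strict_mono_compose[OF j i] _ _ p q] l by (simp add: mem_Times_iff)
  moreover have "e \<le> dist (fst l) (snd l)"
    using far by (intro LIMSEQ_le_const[OF tendsto_dist[OF p q]]) auto
  ultimately show False
    using \<open>0 < e\<close> by simp
qed

lemma uniformly_continuous_on_nearest_point:
  fixes K :: "'a::real_normed_vector set"
  assumes K: "compact K" "convex K" "URED_wrt K" and "bounded S"
    and RK: "\<And>x. x \<in> S \<Longrightarrow> R x \<in> K" and R: "\<And>x. x \<in> S \<Longrightarrow> dist x (R x) = infdist x K"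
  shows "uniformly_continuous_on S R"
  unfolding uniformly_continuous_on_sequentially
proof (intro allI impI, elim conjE)
  fix x y :: "nat \<Rightarrow> 'a"
  assume x: "\<forall>n. x n \<in> S" and y: "\<forall>n. y n \<in> S" and xy: "(\<lambda>n. dist (x n) (y n)) \<longlonglongrightarrow> 0"
  show "(\<lambda>n. dist (R (x n)) (R (y n))) \<longlonglongrightarrow> 0"
  proof (rule compact_dist_tendsto_zero_if_subseq_limits_eq[OF K(1)])
    fix k :: "nat \<Rightarrow> nat" and a b
    assume k: "strict_mono k" and a: "a \<in> K" and b: "b \<in> K"
      and lim: "(\<lambda>n. R (x (k n))) \<longlonglongrightarrow> a" "(\<lambda>n. R (y (k n))) \<longlonglongrightarrow> b"
    have nearest: "asymptotically_nearest K (\<lambda>n. w (k n)) (\<lambda>n. R (w (k n)))"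
      if "\<forall>n. w n \<in> S" for w
      using that R by (simp add: asymptotically_nearest_def)
    have yx: "(\<lambda>n. dist (y (k n)) (x (k n))) \<longlonglongrightarrow> 0"
      using LIMSEQ_subseq_LIMSEQ[OF xy k] by (simp add: o_def dist_commute)
    have xa: "asymptotically_nearest K (\<lambda>n. x (k n)) (\<lambda>_. a)"
      using lim(1) by (intro asymptotically_nearest_perturb[OF nearest[OF x]])
        (simp_all flip: tendsto_dist_iff)
    have xb: "asymptotically_nearest K (\<lambda>n. x (k n)) (\<lambda>_. b)"
      using lim(2) by (intro asymptotically_nearest_perturb[OF nearest[OF y] yx])
        (simp flip: tendsto_dist_iff)
    have "bounded (range (\<lambda>n. x (k n)))"
      using \<open>bounded S\<close> x by (auto intro: bounded_subset)
    then show "a = b"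
      by (rule asymptotically_nearest_unique[OF K(2,3) a b _ xa xb])
  qed (use RK x y in auto)
qed

lemma compact_attains_infdist:
  assumes "compact K" and "K \<noteq> {}"
  shows "\<exists>y\<in>K. dist x y = infdist x K"
  using setdist_attains_inf[OF assms, of "{x}"]
  by (metis dist_commute infdist_eq_setdist infdist_singleton)

lemma nearest_point_map_iff_infdist:
  assumes "K \<noteq> {}"
  shows "nearest_point_map K R \<longleftrightarrow> (\<forall>x \<in> cball 0 1. R x \<in> K \<and> dist x (R x) = infdist x K)"
  using assms by (simp add: nearest_point_map_def infdist_notempty dist_norm norm_minus_commute)

theorem proposition6p7:
  fixes K :: "'a::banach set"
  assumes "K \<noteq> {}" and "K \<subseteq> cball 0 1" and "compact K" and "convex K"
    and "URED_wrt K"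
  shows "\<exists>R. nearest_point_map K R
    \<and> (\<forall>S. nearest_point_map K S \<longrightarrow> (\<forall>x \<in> cball 0 1. S x = R x))
    \<and> uniformly_continuous_on (cball 0 1) R"
proof -
  obtain R where R: "\<And>x. R x \<in> K" "\<And>x. dist x (R x) = infdist x K"
    using compact_attains_infdist[OF assms(3,1)] by metis
  show ?thesis
  proof (intro exI conjI allI impI ballI)
    show "nearest_point_map K R"
      by (simp add: nearest_point_map_iff_infdist[OF assms(1)] R)
    show "S x = R x" if "nearest_point_map K S" and "x \<in> cball 0 1" for S x
      using that by (intro nearest_point_unique[OF assms(4,5) _ _ R])
        (simp_all add: nearest_point_map_iff_infdist[OF assms(1)])
    show "uniformly_continuous_on (cball 0 1) R"
      using assms(3-5) bounded_cball R by (rule uniformly_continuous_on_nearest_point)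
  qed
qed

end
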